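(* Let $\Delta$ be a pure two-dimensional simplicial complex on $n\ge 6$ vertices. Then the following are equivalent: (a) $I_\Delta^{(m)}=I_\Delta^m$ for some $m\ge 4$; (b) $I_\Delta^{(m)}=I_\Delta^m$ for all $m\ge 1$; (c) $n=6$, $\overline{\Delta_1}$ has three pairwise disjoint edges and $\Delta_1$ has two disjoint triangles.
   Context: Let $K$ be a field and $R=K[x_1,\dots,x_n]$. A simplicial complex $\Delta$ on the vertex set $[n]=\{1,\dots,n\}$ is assumed to satisfy $\{i\}\in\Delta$ for every $i\in[n]$. A facet is a maximal face; $\mathcal F(\Delta)$ is the set of facets; $\Delta$ is pure if all facets have the same dimension. The Stanley-Reisner ideal is $I_\Delta=(x_{i_1}\cdots x_{i_s} : \{i_1,\dots,i_s\}\notin\Delta)$. The $m$-th symbolic power is $I_\Delta^{(m)}=\bigcap_{F\in\mathcal F(\Delta)}P_F^m$, where $P_F=(x_i : i\notin F)$. $\Delta_1$ denotes the graph on $[n]$ whose edges are the two-element faces of $\Delta$, and $\overline{\Delta_1}$ is its complement graph on $[n]$. A triangle of $\Delta_1$ is a set of three pairwise adjacent vertices of $\Delta_1$ (it need not be a face of $\Delta$). Disjoint means having no common vertex. *)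

theory Defs
  imports Complex_Main "HOL-Library.Poly_Mapping" "HOL-Library.Cardinality"
begin

section \<open>Polynomials and ideals\<close>

text \<open>A finite type \<open>'v\<close> serves both as the vertex set $[n]$ and as the index set of the
  variables, so $n$ is \<open>CARD('v)\<close>. An element of \<open>'v \<Rightarrow>\<^sub>0 nat\<close> is an exponent vector, and the
  multiplication of \<open>('v \<Rightarrow>\<^sub>0 nat) \<Rightarrow>\<^sub>0 'k\<close> is convolution, so this type is
  $K[x_v : v \in V]$.\<close>

type_synonym ('v, 'k) mpoly = "('v \<Rightarrow>\<^sub>0 nat) \<Rightarrow>\<^sub>0 'k"

definition var :: "'v \<Rightarrow> ('v, 'k::comm_ring_1) mpoly" where
  "var v = Poly_Mapping.single (Poly_Mapping.single v 1) 1"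

text \<open>Viewing a commutative ring as a module over itself, \<open>ideal.span S\<close> is the ideal generated
  by \<open>S\<close>.\<close>

interpretation ideal: module "(*) :: 'a \<Rightarrow> 'a \<Rightarrow> 'a::comm_ring_1"
  by standard (simp_all add: algebra_simps)

definition ideal_power :: "'a::comm_ring_1 set \<Rightarrow> nat \<Rightarrow> 'a set" where
  "ideal_power I m = ideal.span {\<Prod>i<m. f i | f. \<forall>i<m. f i \<in> I}"

section \<open>Simplicial complexes\<close>

definition simplicial_complex :: "'v set set \<Rightarrow> bool" where
  "simplicial_complex \<Delta> \<longleftrightarrow> (\<forall>F\<in>\<Delta>. \<forall>G\<subseteq>F. G \<in> \<Delta>) \<and> (\<forall>v. {v} \<in> \<Delta>)"

definition facets :: "'v set set \<Rightarrow> 'v set set" where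
  "facets \<Delta> = {F \<in> \<Delta>. \<forall>G\<in>\<Delta>. F \<subseteq> G \<longrightarrow> G = F}"

definition face_dim :: "'v set \<Rightarrow> int" where
  "face_dim F = int (card F) - 1"

definition complex_dim :: "'v set set \<Rightarrow> int" where
  "complex_dim \<Delta> = Max (face_dim ` \<Delta>)"

definition pure :: "'v set set \<Rightarrow> bool" where
  "pure \<Delta> \<longleftrightarrow> (\<forall>F\<in>facets \<Delta>. \<forall>G\<in>facets \<Delta>. face_dim F = face_dim G)"

section \<open>The Stanley-Reisner ideal and its symbolic powers\<close>

definition SR_ideal :: "'v set set \<Rightarrow> ('v, 'k::field) mpoly set" where
  "SR_ideal \<Delta> = ideal.span {\<Prod>v\<in>F. var v | F. F \<notin> \<Delta>}"

definition facet_ideal :: "'v set \<Rightarrow> ('v, 'k::field) mpoly set" where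
  "facet_ideal F = ideal.span {var v | v. v \<notin> F}"

definition SR_symbolic_power :: "'v set set \<Rightarrow> nat \<Rightarrow> ('v, 'k::field) mpoly set" where
  "SR_symbolic_power \<Delta> m = (\<Inter>F\<in>facets \<Delta>. ideal_power (facet_ideal F) m)"

section \<open>Graphs\<close>

text \<open>A graph on the vertex set \<open>UNIV\<close> is given by its set of edges, which are two-element sets.\<close>

definition skeleton1 :: "'v set set \<Rightarrow> 'v set set" where
  "skeleton1 \<Delta> = {e \<in> \<Delta>. card e = 2}"

definition complement_graph :: "'v set set \<Rightarrow> 'v set set" where
  "complement_graph E = {e. card e = 2 \<and> e \<notin> E}"

definition triangle :: "'v set set \<Rightarrow> 'v set \<Rightarrow> bool" where
  "triangle E T \<longleftrightarrow> card T = 3 \<and> (\<forall>u\<in>T. \<forall>v\<in>T. u \<noteq> v \<longrightarrow> {u, v} \<in> E)"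

end

theory Submission
  imports Defs
begin

text \<open>All ideals involved are monomial, so the equality of the \<open>m\<close>-th powers says: whenever an exponent
  vector \<open>a\<close> has weight at least \<open>m\<close> outside every facet, \<open>m\<close> nonfaces can be packed into \<open>a\<close>. If
  \<open>G\<close> is a nonface of minimal size \<open>g\<close>, adding copies of \<open>G\<close> to a vector \<open>b\<close> of weight at least
  \<open>k \<le> m\<close> outside every facet shows that \<open>b\<close> has degree at least \<open>g * k\<close>. For indicators of 5
  vertices, of 7 vertices and of a triangle of the complement graph this gives \<open>g = 2\<close>, then
  \<open>n = 6\<close>, then the absence of such triangles. For the all-ones vector plus copies of one nonedge the
  packing is perfect, which yields Hall's condition between a facet and its complement and hence
  three disjoint nonedges; since every facet is transversal to them, some antipodal pair of
  transversals consists of triangles of the skeleton.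

  Conversely, given three disjoint nonedges, every facet meets each of them exactly once, so nonedges
  inside the support of \<open>a\<close> can be split off one at a time until the support lies in a
  transversal. The two disjoint triangles ensure that some edge of this transversal is a face, and
  then a packing can be written down.\<close>

section \<open>Powers of monomial ideals\<close>

lemma poly_mapping_sum_single:
  fixes p :: "'a \<Rightarrow>\<^sub>0 'b::comm_monoid_add"
  shows "(\<Sum>a\<in>Poly_Mapping.keys p. Poly_Mapping.single a (Poly_Mapping.lookup p a)) = p"
  by (rule poly_mapping_eqI)
    (simp add: lookup_sum lookup_single when_def in_keys_iff)

lemma prod_single_one:
  "(\<Prod>i\<in>A. Poly_Mapping.single (f i) (1::'b::comm_semiring_1)) = Poly_Mapping.single (\<Sum>i\<in>A. f i) 1"
  for f :: "'i \<Rightarrow> 'a::comm_monoid_add"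
  by (induction A rule: infinite_finite_induct) (simp_all add: mult_single)

text \<open>Exponents of a product are sums of exponents of the factors, so a set of exponents
  closed under adding arbitrary vectors yields an ideal.\<close>

lemma subspace_keys:
  fixes U :: "('v \<Rightarrow>\<^sub>0 nat) set"
  assumes "\<And>a c. a \<in> U \<Longrightarrow> a + c \<in> U"
  shows "ideal.subspace {p :: ('v, 'k::comm_ring_1) mpoly. Poly_Mapping.keys p \<subseteq> U}"
proof (rule ideal.subspaceI)
  show "p + q \<in> {p. Poly_Mapping.keys p \<subseteq> U}" if "p \<in> {p. Poly_Mapping.keys p \<subseteq> U}" "q \<in> {p. Poly_Mapping.keys p \<subseteq> U}"
    for p q :: "('v, 'k) mpoly"
    using that keys_add[of p q] by blast
  show "c * p \<in> {p. Poly_Mapping.keys p \<subseteq> U}" if "p \<in> {p. Poly_Mapping.keys p \<subseteq> U}" for c p :: "('v, 'k) mpoly"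
    using that keys_mult[of c p] assms by (auto simp: subset_iff) (metis add.commute)
qed simp

text \<open>A polynomial is the sum of its terms, and a term lies in the ideal as soon as some
  generator divides it.\<close>

lemma span_monomials:
  fixes S :: "('v \<Rightarrow>\<^sub>0 nat) set"
  shows "ideal.span ((\<lambda>s. Poly_Mapping.single s 1) ` S)
       = {p :: ('v, 'k::comm_ring_1) mpoly. Poly_Mapping.keys p \<subseteq> {s + c | s c. s \<in> S}}" (is "ideal.span ?M = ?R")
proof
  have "ideal.subspace ?R"
  proof (rule subspace_keys)
    show "a + c \<in> {s + c | s c. s \<in> S}" if "a \<in> {s + c | s c. s \<in> S}" for a c
      using that by clarify (use add.assoc in blast)
  qed
  moreover have "?M \<subseteq> ?R"
    by (force simp: image_subset_iff intro: exI[of _ 0])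
  ultimately show "ideal.span ?M \<subseteq> ?R"
    by (intro ideal.span_minimal)
  show "?R \<subseteq> ideal.span ?M"
  proof
    fix p :: "('v, 'k) mpoly"
    assume p: "p \<in> ?R"
    have "Poly_Mapping.single a (Poly_Mapping.lookup p a) \<in> ideal.span ?M" if a: "a \<in> Poly_Mapping.keys p" for a
    proof -
      obtain s c where sc: "s \<in> S" "a = s + c"
        using p a by blast
      have "Poly_Mapping.single c (Poly_Mapping.lookup p a) * Poly_Mapping.single s 1 \<in> ideal.span ?M"
        by (intro ideal.span_scale ideal.span_base) (use sc in auto)
      then show ?thesis
        by (simp add: mult_single sc add.commute)
    qed
    then have "(\<Sum>a\<in>Poly_Mapping.keys p. Poly_Mapping.single a (Poly_Mapping.lookup p a)) \<in> ideal.span ?M"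
      by (rule ideal.span_sum)
    then show "p \<in> ideal.span ?M"
      by (simp only: poly_mapping_sum_single)
  qed
qed

text \<open>Multiplying out \<open>m\<close> elements of the ideal produces only terms divisible by
  \<open>m\<close> generators; \<open>c\<close> is the exponent of the cofactor.\<close>

lemma ideal_power_span_monomials:
  fixes S :: "('v \<Rightarrow>\<^sub>0 nat) set"
  shows "ideal_power (ideal.span ((\<lambda>s. Poly_Mapping.single s 1) ` S)) m
       = {p :: ('v, 'k::comm_ring_1) mpoly.
            Poly_Mapping.keys p \<subseteq> {(\<Sum>i<m. f i) + c | f c. \<forall>i<m. f i \<in> S}}" (is "ideal_power ?I m = ?R m")
proof
  have "ideal.subspace (?R m)"
  proof (rule subspace_keys)
    show "a + c \<in> {(\<Sum>i<m. f i) + c | f c. \<forall>i<m. f i \<in> S}" if "a \<in> {(\<Sum>i<m. f i) + c | f c. \<forall>i<m. f i \<in> S}" for a c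
      using that by clarify (use add.assoc in blast)
  qed
  moreover have "(\<Prod>i<m. f i) \<in> ?R m" if "\<forall>i<m. f i \<in> ?I" for f
    using that
  proof (induction m)
    case 0
    then show ?case by auto
  next
    case (Suc m)
    have IH: "(\<Prod>i<m. f i) \<in> ?R m" using Suc by simp
    have fm: "Poly_Mapping.keys (f m) \<subseteq> {s + c | s c. s \<in> S}"
      using Suc.prems by (simp add: span_monomials)
    show ?case
    proof (clarify)
      fix a assume "a \<in> Poly_Mapping.keys (\<Prod>i<Suc m. f i)"
      then obtain b c where bc: "b \<in> Poly_Mapping.keys (\<Prod>i<m. f i)" "c \<in> Poly_Mapping.keys (f m)" "a = b + c"
        using keys_mult[of "\<Prod>i<m. f i" "f m"] by auto
      obtain g d where g: "b = (\<Sum>i<m. g i) + d" "\<forall>i<m. g i \<in> S"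
        using IH bc(1) by blast
      obtain s e where s: "c = s + e" "s \<in> S"
        using fm bc(2) by blast
      have "a = (\<Sum>i<Suc m. (g(m := s)) i) + (d + e)"
        using bc g s by (simp add: ac_simps)
      moreover have "\<forall>i<Suc m. (g(m := s)) i \<in> S"
        using g s by (simp add: less_Suc_eq)
      ultimately show "\<exists>f c. a = (\<Sum>i<Suc m. f i) + c \<and> (\<forall>i<Suc m. f i \<in> S)"
        by blast
    qed
  qed
  then have "{\<Prod>i<m. f i | f. \<forall>i<m. f i \<in> ?I} \<subseteq> ?R m"
    by blast
  ultimately show "ideal_power ?I m \<subseteq> ?R m"
    unfolding ideal_power_def by (rule ideal.span_minimal[rotated])
next
  \<comment> \<open>By \<open>span_monomials\<close> the right-hand side is spanned by the products
    of \<open>m\<close> generating monomials, so it suffices to find these among the products on the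
    left.\<close>
  have "(\<lambda>s. Poly_Mapping.single s 1) ` {\<Sum>i<m. f i | f. \<forall>i<m. f i \<in> S}
      \<subseteq> {\<Prod>i<m. f i | f. \<forall>i<m. f i \<in> ?I}"
  proof clarify
    fix f :: "nat \<Rightarrow> 'v \<Rightarrow>\<^sub>0 nat" assume f: "\<forall>i<m. f i \<in> S"
    then have "\<forall>i<m. Poly_Mapping.single (f i) 1 \<in> ?I"
      by (auto intro: ideal.span_base)
    then show "\<exists>g. Poly_Mapping.single (\<Sum>i<m. f i) 1 = (\<Prod>i<m. g i) \<and> (\<forall>i<m. g i \<in> ?I)"
      by (intro exI[of _ "\<lambda>i. Poly_Mapping.single (f i) 1"]) (simp add: prod_single_one)
  qed
  from ideal.span_mono[OF this]
  show "?R m \<subseteq> ideal_power ?I m"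
    unfolding ideal_power_def span_monomials by (elim subset_trans[rotated]) blast
qed

section \<open>Membership in both kinds of powers, read off from exponent vectors\<close>

lemma ideal_power_facet_ideal:
  fixes F :: "'v::finite set"
  shows "ideal_power (facet_ideal F) m
       = {p :: ('v, 'k::field) mpoly. \<forall>a\<in>Poly_Mapping.keys p. m \<le> (\<Sum>v\<in>-F. Poly_Mapping.lookup a v)}"
proof -
  let ?S = "{Poly_Mapping.single v (1::nat) | v. v \<notin> F}"
  have I: "(facet_ideal F :: ('v, 'k) mpoly set) = ideal.span ((\<lambda>s. Poly_Mapping.single s 1) ` ?S)"
    unfolding facet_ideal_def var_def by (rule arg_cong[where f = ideal.span]) blast
  have "(\<exists>f c. a = (\<Sum>i<m. f i) + c \<and> (\<forall>i<m. f i \<in> ?S)) \<longleftrightarrow> m \<le> (\<Sum>v\<in>-F. Poly_Mapping.lookup a v)" for a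
  proof
    assume "\<exists>f c. a = (\<Sum>i<m. f i) + c \<and> (\<forall>i<m. f i \<in> ?S)"
    then obtain f c where f: "a = (\<Sum>i<m. f i) + c" "\<forall>i<m. f i \<in> ?S" by blast
    have "(\<Sum>v\<in>-F. Poly_Mapping.lookup (f i) v) = 1" if "i < m" for i
      using f(2) that by (auto simp: lookup_single when_def)
    then have "m = (\<Sum>i<m. \<Sum>v\<in>-F. Poly_Mapping.lookup (f i) v)" by simp
    also have "\<dots> = (\<Sum>v\<in>-F. \<Sum>i<m. Poly_Mapping.lookup (f i) v)" by (rule sum.swap)
    also have "\<dots> \<le> (\<Sum>v\<in>-F. Poly_Mapping.lookup a v)"
      by (rule sum_mono) (simp add: f(1) lookup_add lookup_sum)
    finally show "m \<le> (\<Sum>v\<in>-F. Poly_Mapping.lookup a v)" .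
  next
    assume "m \<le> (\<Sum>v\<in>-F. Poly_Mapping.lookup a v)"
    then show "\<exists>f c. a = (\<Sum>i<m. f i) + c \<and> (\<forall>i<m. f i \<in> ?S)"
    proof (induction m arbitrary: a)
      case (Suc m)
      \<comment> \<open>One variable outside \<open>F\<close> is split off per step, which lowers
        the weight outside \<open>F\<close> by exactly 1.\<close>
      then obtain v where v: "v \<notin> F" "Poly_Mapping.lookup a v > 0"
        by (metis ComplD gr0I not_less_eq_eq sum.neutral zero_le)
      let ?b = "a - Poly_Mapping.single v 1"
      have ab: "a = ?b + Poly_Mapping.single v 1"
        by (rule poly_mapping_eqI) (use v in \<open>auto simp: lookup_add lookup_minus lookup_single when_def\<close>)
      have "(\<Sum>u\<in>-F. Poly_Mapping.lookup a u) = (\<Sum>u\<in>-F. Poly_Mapping.lookup ?b u) + 1"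
        by (subst ab) (use v in \<open>simp add: lookup_add sum.distrib lookup_single when_def\<close>)
      then obtain f c where f: "?b = (\<Sum>i<m. f i) + c" "\<forall>i<m. f i \<in> ?S"
        using Suc.IH[of ?b] Suc.prems by auto
      have "a = (\<Sum>i<m. f i) + c + Poly_Mapping.single v 1"
        using ab f(1) by simp
      then have "a = (\<Sum>i<Suc m. (f(m := Poly_Mapping.single v 1)) i) + c"
        by (simp add: ac_simps)
      moreover have "\<forall>i<Suc m. (f(m := Poly_Mapping.single v 1)) i \<in> ?S"
        using f(2) v by (auto simp: less_Suc_eq)
      ultimately show ?case by blast
    qed simp
  qed
  then show ?thesis
    unfolding I ideal_power_span_monomials by blast
qed

text \<open>Says that the monomial with exponent \<open>a\<close> lies in the \<open>m\<close>-th
  symbolic power, without reference to the field.\<close>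

definition covers :: "'v::finite set set \<Rightarrow> nat \<Rightarrow> ('v \<Rightarrow> nat) \<Rightarrow> bool" where
  "covers \<Delta> m a \<longleftrightarrow> (\<forall>F\<in>facets \<Delta>. m \<le> (\<Sum>v\<in>-F. a v))"

text \<open>The counterpart for the ordinary power: a product of \<open>m\<close> squarefree nonface
  monomials, repetitions allowed, divides the monomial with exponent \<open>a\<close>.\<close>

definition packs :: "'v set set \<Rightarrow> nat \<Rightarrow> ('v \<Rightarrow> nat) \<Rightarrow> bool" where
  "packs \<Delta> m a \<longleftrightarrow> (\<exists>G. (\<forall>i<m. G i \<notin> \<Delta>) \<and> (\<forall>v. (\<Sum>i<m. of_bool (v \<in> G i)) \<le> a v))"

lemma SR_symbolic_power_eq:
  "SR_symbolic_power \<Delta> m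
     = {p :: ('v::finite, 'k::field) mpoly. \<forall>a\<in>Poly_Mapping.keys p. covers \<Delta> m (Poly_Mapping.lookup a)}"
  unfolding SR_symbolic_power_def ideal_power_facet_ideal covers_def by blast

lemma lookup_sum_squarefree:
  "Poly_Mapping.lookup (\<Sum>i<m. \<Sum>v\<in>G i. Poly_Mapping.single v (1::nat)) u = (\<Sum>i<m. of_bool (u \<in> G i))"
  for G :: "nat \<Rightarrow> 'v::finite set"
  by (simp add: lookup_sum lookup_single when_def of_bool_def del: sum_of_bool_eq One_nat_def)

lemma ideal_power_SR_ideal:
  "ideal_power (SR_ideal \<Delta>) m
     = {p :: ('v::finite, 'k::field) mpoly. \<forall>a\<in>Poly_Mapping.keys p. packs \<Delta> m (Poly_Mapping.lookup a)}"
proof -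
  let ?x = "\<lambda>G :: 'v set. \<Sum>v\<in>G. Poly_Mapping.single v (1::nat)"
  have I: "(SR_ideal \<Delta> :: ('v, 'k) mpoly set) = ideal.span ((\<lambda>s. Poly_Mapping.single s 1) ` ?x ` (-\<Delta>))"
    unfolding SR_ideal_def var_def prod_single_one by (rule arg_cong[where f = ideal.span]) blast
  have "(\<exists>f c. a = (\<Sum>i<m. f i) + c \<and> (\<forall>i<m. f i \<in> ?x ` (-\<Delta>))) \<longleftrightarrow> packs \<Delta> m (Poly_Mapping.lookup a)" for a
  proof
    assume "\<exists>f c. a = (\<Sum>i<m. f i) + c \<and> (\<forall>i<m. f i \<in> ?x ` (-\<Delta>))"
    then obtain f c where f: "a = (\<Sum>i<m. f i) + c" "\<forall>i<m. f i \<in> ?x ` (-\<Delta>)" by blast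
    have "\<forall>i. \<exists>G. i < m \<longrightarrow> G \<notin> \<Delta> \<and> f i = ?x G"
      using f(2) by blast
    then obtain G where G: "\<forall>i<m. G i \<notin> \<Delta> \<and> f i = ?x (G i)"
      using choice[of "\<lambda>i G. i < m \<longrightarrow> G \<notin> \<Delta> \<and> f i = ?x G"] by blast
    then have "(\<Sum>i<m. of_bool (v \<in> G i)) = Poly_Mapping.lookup (\<Sum>i<m. f i) v" for v
      by (simp add: lookup_sum_squarefree[symmetric] del: sum_of_bool_eq One_nat_def)
    then show "packs \<Delta> m (Poly_Mapping.lookup a)"
      unfolding packs_def using G f(1) by (intro exI[of _ G]) (simp add: lookup_add del: sum_of_bool_eq)
  next
    assume "packs \<Delta> m (Poly_Mapping.lookup a)"
    then obtain G where G: "\<forall>i<m. G i \<notin> \<Delta>" "\<forall>v. (\<Sum>i<m. of_bool (v \<in> G i)) \<le> Poly_Mapping.lookup a v"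
      unfolding packs_def by blast
    \<comment> \<open>The truncated subtraction is exact because the packing inequality bounds every
      exponent.\<close>
    have "a = (\<Sum>i<m. ?x (G i)) + (a - (\<Sum>i<m. ?x (G i)))"
    proof (rule poly_mapping_eqI)
      fix v
      have "Poly_Mapping.lookup (\<Sum>i<m. ?x (G i)) v \<le> Poly_Mapping.lookup a v"
        using G(2) by (simp only: lookup_sum_squarefree)
      then show "Poly_Mapping.lookup a v = Poly_Mapping.lookup ((\<Sum>i<m. ?x (G i)) + (a - (\<Sum>i<m. ?x (G i)))) v"
        by (simp add: lookup_add lookup_minus)
    qed
    then show "\<exists>f c. a = (\<Sum>i<m. f i) + c \<and> (\<forall>i<m. f i \<in> ?x ` (-\<Delta>))"
      using G(1) by blast
  qed
  then show ?thesis
    unfolding I ideal_power_span_monomials by blast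
qed

text \<open>A nonface is not contained in a facet, so each of the \<open>m\<close> packed sets
  contributes a vertex outside it. This is the inclusion of the ordinary power in the symbolic
  one.\<close>

lemma packs_imp_covers:
  assumes "packs \<Delta> m a" and down: "\<And>F G. F \<in> \<Delta> \<Longrightarrow> G \<subseteq> F \<Longrightarrow> G \<in> \<Delta>"
  shows "covers \<Delta> m a"
  unfolding covers_def
proof
  fix F assume F: "F \<in> facets \<Delta>"
  obtain G where G: "\<forall>i<m. G i \<notin> \<Delta>" "\<forall>v. (\<Sum>i<m. of_bool (v \<in> G i)) \<le> a v"
    using assms(1) unfolding packs_def by blast
  have "1 \<le> (\<Sum>v\<in>-F. of_bool (v \<in> G i) :: nat)" if i: "i < m" for i
  proof -
    obtain v where "v \<in> G i" "v \<notin> F"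
      using G(1) i F down[of F "G i"] unfolding facets_def by blast
    then have "(\<Sum>v\<in>{v}. of_bool (v \<in> G i)) \<le> (\<Sum>v\<in>-F. of_bool (v \<in> G i) :: nat)"
      by (intro sum_mono2) auto
    with \<open>v \<in> G i\<close> show ?thesis by simp
  qed
  then have "(\<Sum>i<m. 1) \<le> (\<Sum>i<m. \<Sum>v\<in>-F. of_bool (v \<in> G i) :: nat)"
    by (intro sum_mono) auto
  also have "\<dots> = (\<Sum>v\<in>-F. \<Sum>i<m. of_bool (v \<in> G i))" by (rule sum.swap)
  also have "\<dots> \<le> (\<Sum>v\<in>-F. a v)" by (rule sum_mono) (use G(2) in blast)
  finally show "m \<le> (\<Sum>v\<in>-F. a v)" by simp
qed

text \<open>Both ideals are determined by their monomials and one inclusion always holds, so the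
  problem becomes purely combinatorial.\<close>

lemma powers_eq_iff:
  assumes "simplicial_complex \<Delta>"
  shows "(SR_symbolic_power \<Delta> m :: ('v::finite, 'k::field) mpoly set) = ideal_power (SR_ideal \<Delta>) m
         \<longleftrightarrow> (\<forall>a. covers \<Delta> m a \<longrightarrow> packs \<Delta> m a)" (is "?S = ?I \<longleftrightarrow> _")
proof
  assume eq: "?S = ?I"
  show "\<forall>a. covers \<Delta> m a \<longrightarrow> packs \<Delta> m a"
  proof (intro allI impI)
    fix a assume a: "covers \<Delta> m a"
    \<comment> \<open>As \<open>'v\<close> is finite, every function is an exponent vector; its
      monomial is the test element.\<close>
    let ?a = "Abs_poly_mapping a"
    have [simp]: "Poly_Mapping.lookup ?a = a" by (simp add: lookup_Abs_poly_mapping)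
    have "(Poly_Mapping.single ?a 1 :: ('v, 'k) mpoly) \<in> ?S"
      using a by (simp add: SR_symbolic_power_eq)
    then show "packs \<Delta> m a"
      unfolding eq by (simp add: ideal_power_SR_ideal)
  qed
next
  assume "\<forall>a. covers \<Delta> m a \<longrightarrow> packs \<Delta> m a"
  moreover have "packs \<Delta> m a \<Longrightarrow> covers \<Delta> m a" for a
    using assms packs_imp_covers[of \<Delta> m a] unfolding simplicial_complex_def by blast
  ultimately show "?S = ?I"
    unfolding SR_symbolic_power_eq ideal_power_SR_ideal by blast
qed

section \<open>Packing nonfaces\<close>

lemma sum_count_swap:
  "(\<Sum>v\<in>A. \<Sum>i<m. of_bool (v \<in> G i)) = (\<Sum>i<m. card (G i \<inter> A))" if "finite A"
  for G :: "nat \<Rightarrow> 'v set"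
proof -
  have "(\<Sum>v\<in>A. \<Sum>i<m. of_bool (v \<in> G i)) = (\<Sum>i<m. \<Sum>v\<in>A. of_bool (v \<in> G i) :: nat)"
    by (rule sum.swap)
  also have "\<dots> = (\<Sum>i<m. card (G i \<inter> A))"
    by (rule sum.cong) (use that in \<open>simp_all add: Int_commute Int_def\<close>)
  finally show ?thesis .
qed

lemma packs_const:
  assumes "G \<notin> \<Delta>" "\<And>v. v \<in> G \<Longrightarrow> m \<le> a v"
  shows "packs \<Delta> m a"
  unfolding packs_def using assms by (intro exI[of _ "\<lambda>_. G"]) auto

lemma packs_Suc:
  assumes "G \<notin> \<Delta>" "\<And>v. v \<in> G \<Longrightarrow> 1 \<le> a v" "packs \<Delta> m (\<lambda>v. a v - of_bool (v \<in> G))"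
  shows "packs \<Delta> (Suc m) a"
proof -
  obtain H where H: "\<forall>i<m. H i \<notin> \<Delta>"
    "\<And>v. (\<Sum>i<m. of_bool (v \<in> H i)) \<le> a v - of_bool (v \<in> G)"
    using assms(3) unfolding packs_def by blast
  have "(\<Sum>i<Suc m. of_bool (v \<in> (H(m := G)) i)) \<le> a v" for v
    using H(2)[of v] assms(2)[of v]
    by (cases "v \<in> G") (simp_all del: sum_of_bool_eq)
  then show ?thesis
    unfolding packs_def using H(1) assms(1)
    by (intro exI[of _ "H(m := G)"]) (simp add: less_Suc_eq del: sum_of_bool_eq)
qed

lemma packs_size:
  fixes a :: "'v::finite \<Rightarrow> nat"
  assumes "packs \<Delta> m a" "\<And>G. G \<notin> \<Delta> \<Longrightarrow> g \<le> card G"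
  shows "g * m \<le> (\<Sum>v\<in>UNIV. a v)"
proof -
  obtain G where G: "\<forall>i<m. G i \<notin> \<Delta>" "\<And>v. (\<Sum>i<m. of_bool (v \<in> G i)) \<le> a v"
    using assms(1) unfolding packs_def by blast
  have "g * m = (\<Sum>i<m. g)" by simp
  also have "\<dots> \<le> (\<Sum>i<m. card (G i \<inter> UNIV))"
    by (rule sum_mono) (use G(1) assms(2) in auto)
  also have "\<dots> = (\<Sum>v\<in>UNIV. \<Sum>i<m. of_bool (v \<in> G i))"
    by (rule sum_count_swap[symmetric]) simp
  also have "\<dots> \<le> (\<Sum>v\<in>UNIV. a v)"
    by (rule sum_mono) (rule G(2))
  finally show ?thesis .
qed

text \<open>Every facet misses a vertex of \<open>G\<close>, so each copy of \<open>G\<close> adds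
  at least 1 to the weight outside it. This lifts covers of small weight to a prescribed
  exponent.\<close>

lemma covers_add_copies:
  assumes "covers \<Delta> k b" "G \<notin> \<Delta>" and down: "\<And>F G. F \<in> \<Delta> \<Longrightarrow> G \<subseteq> F \<Longrightarrow> G \<in> \<Delta>"
  shows "covers \<Delta> (k + j) (\<lambda>v. b v + j * of_bool (v \<in> G))"
  unfolding covers_def
proof
  fix F assume F: "F \<in> facets \<Delta>"
  obtain u where u: "u \<in> G" "u \<notin> F"
    using F down[of F G] assms(2) unfolding facets_def by blast
  have "j = (\<Sum>v\<in>{u}. j * of_bool (v \<in> G))" using u by simp
  also have "\<dots> \<le> (\<Sum>v\<in>-F. j * of_bool (v \<in> G))"
    by (rule sum_mono2) (use u in auto)
  finally show "k + j \<le> (\<Sum>v\<in>-F. b v + j * of_bool (v \<in> G))"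
    using assms(1) F unfolding covers_def sum.distrib by (intro add_mono) auto
qed

text \<open>Hall's marriage theorem for three sets. That a union has at least \<open>k\<close>
  elements is expressed by its not being exhausted by \<open>k - 1\<close> points.\<close>

lemma distinct_representatives_3:
  assumes "\<exists>x. x \<in> A" "\<exists>x. x \<in> B" "\<exists>x. x \<in> C"
    and "\<And>x. \<exists>y. y \<in> A \<union> B \<and> y \<noteq> x" "\<And>x. \<exists>y. y \<in> A \<union> C \<and> y \<noteq> x"
      "\<And>x. \<exists>y. y \<in> B \<union> C \<and> y \<noteq> x"
    and three: "\<And>x y. \<exists>z. z \<in> A \<union> B \<union> C \<and> z \<noteq> x \<and> z \<noteq> y"
  shows "\<exists>x y z. x \<in> A \<and> y \<in> B \<and> z \<in> C \<and> x \<noteq> y \<and> x \<noteq> z \<and> y \<noteq> z"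
proof -
  obtain x y where xy: "x \<in> A" "y \<in> B" "x \<noteq> y"
    using assms(1,2) assms(4) by (metis UnE)
  show ?thesis
  \<comment> \<open>If \<open>C\<close> offers no new point, a third point \<open>z\<close> of
    \<open>A\<close> or \<open>B\<close> permits an exchange that frees \<open>x\<close> or
    \<open>y\<close> for \<open>C\<close>.\<close>
  proof (cases "C \<subseteq> {x, y}")
    case False
    then show ?thesis using xy by blast
  next
    case C: True
    obtain z where z: "z \<in> A \<union> B \<union> C" "z \<noteq> x" "z \<noteq> y"
      using three by blast
    then consider "z \<in> A" | "z \<in> B" using C by blast
    then show ?thesis
    proof cases
      case 1
      show ?thesis
      proof (cases "x \<in> C")
        case True
        then show ?thesis using 1 xy z by blast
      next
        case False
        then have "C = {y}" using C assms(3) by blast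
        moreover obtain w where "w \<in> B \<union> C" "w \<noteq> y" using assms(6) by blast
        ultimately show ?thesis using 1 xy z by blast
      qed
    next
      case 2
      show ?thesis
      proof (cases "y \<in> C")
        case True
        then show ?thesis using 2 xy z by blast
      next
        case False
        then have "C = {x}" using C assms(3) by blast
        moreover obtain w where "w \<in> A \<union> C" "w \<noteq> x" using assms(5) by blast
        ultimately show ?thesis using 2 xy z by blast
      qed
    qed
  qed
qed

text \<open>Purity and dimension two enter as the condition that every facet has three
  vertices.\<close>

locale pure_two_dim_complex =
  fixes \<Delta> :: "'v::finite set set"
  assumes down: "F \<in> \<Delta> \<Longrightarrow> G \<subseteq> F \<Longrightarrow> G \<in> \<Delta>"
    and vertex: "{v} \<in> \<Delta>"
    and card_facet: "F \<in> facets \<Delta> \<Longrightarrow> card F = 3"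
begin

section \<open>Faces, facets and nonfaces\<close>

lemma facet_face: "F \<in> facets \<Delta> \<Longrightarrow> F \<in> \<Delta>"
  by (simp add: facets_def)

lemma ex_facet:
  assumes "F \<in> \<Delta>"
  obtains G where "G \<in> facets \<Delta>" "F \<subseteq> G"
proof -
  obtain G where "G \<in> \<Delta>" "F \<subseteq> G" "\<forall>H\<in>\<Delta>. G \<subseteq> H \<longrightarrow> G = H"
    using finite_has_maximal2[OF finite assms] by blast
  then show thesis using that[of G] by (auto simp: facets_def)
qed

lemma card_facet_Int: "F \<in> facets \<Delta> \<Longrightarrow> card (F \<inter> W) \<le> 3"
  using card_facet[of F] card_mono[of F "F \<inter> W"] by simp

lemma card_face:
  assumes "F \<in> \<Delta>"
  shows "card F \<le> 3"
proof -
  obtain G where "G \<in> facets \<Delta>" "F \<subseteq> G" using ex_facet[OF assms] .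
  then show ?thesis using card_mono[of G F] card_facet by simp
qed

lemma face_card_3_facet:
  assumes "F \<in> \<Delta>" "card F = 3"
  shows "F \<in> facets \<Delta>"
proof -
  obtain G where G: "G \<in> facets \<Delta>" "F \<subseteq> G" using ex_facet[OF assms(1)] .
  then have "F = G" using assms(2) card_facet by (intro card_subset_eq) auto
  then show ?thesis using G by simp
qed

lemma card_nonface: "G \<notin> \<Delta> \<Longrightarrow> 2 \<le> card G"
proof (rule ccontr)
  assume G: "G \<notin> \<Delta>" "\<not> 2 \<le> card G"
  then consider "card G = 0" | "card G = 1" by linarith
  then show False
  proof cases
    case 1
    then show ?thesis using G down[OF vertex, of G] by simp
  next
    case 2
    then show ?thesis using G vertex by (metis card_1_singletonE)
  qed
qed

text \<open>Of the vertices of \<open>W\<close> a facet contains at most \<open>c\<close>, so all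
  others lie outside it.\<close>

lemma covers_indicator:
  assumes "\<And>F. F \<in> facets \<Delta> \<Longrightarrow> card (F \<inter> W) \<le> c"
  shows "covers \<Delta> (card W - c) (\<lambda>v. of_bool (v \<in> W))"
  unfolding covers_def
proof
  fix F assume F: "F \<in> facets \<Delta>"
  have "card W = card (F \<inter> W) + card (-F \<inter> W)"
    by (subst card_Un_disjoint[symmetric]) (auto intro: arg_cong[where f = card])
  then show "card W - c \<le> (\<Sum>v\<in>-F. of_bool (v \<in> W))"
    using assms[OF F] by (simp add: Int_def)
qed

text \<open>A facet contains no nonedge, hence at most one vertex of each pair; its three vertices
  leave no other distribution.\<close>

lemma facet_transversal:
  assumes "e1 \<union> e2 \<union> e3 = UNIV" "e1 \<notin> \<Delta>" "e2 \<notin> \<Delta>" "e3 \<notin> \<Delta>"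
    "card e1 = 2" "card e2 = 2" "card e3 = 2" and F: "F \<in> facets \<Delta>"
  shows "card (F \<inter> e1) = 1" "card (F \<inter> e2) = 1" "card (F \<inter> e3) = 1"
proof -
  have le: "card (F \<inter> e) \<le> 1" if "e \<notin> \<Delta>" "card e = 2" for e
  proof (rule ccontr)
    assume "\<not> card (F \<inter> e) \<le> 1"
    then have "F \<inter> e = e"
      using that card_mono[of e "F \<inter> e"] by (intro card_subset_eq) auto
    then show False
      using that down[OF facet_face[OF F], of e] by blast
  qed
  have "3 = card ((F \<inter> e1) \<union> (F \<inter> e2) \<union> (F \<inter> e3))"
    using card_facet[OF F] assms(1) by (metis Int_Un_distrib Int_UNIV_right)
  also have "\<dots> \<le> card (F \<inter> e1) + card (F \<inter> e2) + card (F \<inter> e3)"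
    by (meson add_le_mono1 card_Un_le le_trans)
  finally show "card (F \<inter> e1) = 1" "card (F \<inter> e2) = 1" "card (F \<inter> e3) = 1"
    using le[of e1] le[of e2] le[of e3] assms by auto
qed

section \<open>Consequences of equality for one exponent\<close>

context
  fixes m :: nat
  assumes m: "4 \<le> m" and eq: "covers \<Delta> m a \<Longrightarrow> packs \<Delta> m a"
begin

text \<open>The \<open>m - k\<close> added copies of the minimal nonface \<open>G\<close> raise the
  degree by exactly what the packing bound charges for them, so they cancel and a bound on
  \<open>b\<close> remains.\<close>

lemma size_bound:
  assumes "G \<notin> \<Delta>" "\<And>H. H \<notin> \<Delta> \<Longrightarrow> card G \<le> card H" "covers \<Delta> k b" "k \<le> m"
  shows "card G * k \<le> (\<Sum>v\<in>UNIV. b v)"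
proof -
  let ?a = "\<lambda>v. b v + (m - k) * of_bool (v \<in> G)"
  have "covers \<Delta> (k + (m - k)) ?a"
    by (rule covers_add_copies) (use assms down in auto)
  then have "packs \<Delta> m ?a" using eq assms(4) by simp
  then have "card G * m \<le> (\<Sum>v\<in>UNIV. ?a v)"
    using packs_size assms(2) by blast
  also have "\<dots> = (\<Sum>v\<in>UNIV. b v) + (m - k) * card G"
    by (simp add: sum.distrib sum_distrib_left[symmetric])
  also have "card G * m = card G * k + card G * (m - k)"
    using assms(4) by (simp add: add_mult_distrib2[symmetric])
  finally show ?thesis by (simp add: mult.commute)
qed

lemma ex_nonedge:
  assumes "6 \<le> CARD('v)"
  shows "\<exists>e. e \<notin> \<Delta> \<and> card e = 2"
proof -
  have "UNIV \<notin> \<Delta>" using card_face assms by fastforce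
  then obtain G where G: "G \<notin> \<Delta>" "\<And>H. H \<notin> \<Delta> \<Longrightarrow> card G \<le> card H"
    using ex_has_least_nat[of "\<lambda>G. G \<notin> \<Delta>" UNIV card] by blast
  \<comment> \<open>At least 2 of 5 vertices lie outside each facet, so twice the minimal size of a
    nonface is at most 5.\<close>
  obtain W :: "'v set" where W: "card W = 5"
    using obtain_subset_with_card_n[of 5 "UNIV :: 'v set"] assms by auto
  have "covers \<Delta> (card W - 3) (\<lambda>v. of_bool (v \<in> W))"
    by (rule covers_indicator) (rule card_facet_Int)
  from size_bound[OF G this] have "card G \<le> 2" using W m by simp
  then show ?thesis using G card_nonface[of G] by (intro exI[of _ G]) simp
qed

lemma nonedge_size_bound:
  assumes "e \<notin> \<Delta>" "card e = 2" "covers \<Delta> k b" "k \<le> m"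
  shows "2 * k \<le> (\<Sum>v\<in>UNIV. b v)"
  using size_bound[of e k b] assms card_nonface by simp

lemma card_vertices:
  assumes "6 \<le> CARD('v)"
  shows "CARD('v) = 6"
proof (rule ccontr)
  assume "CARD('v) \<noteq> 6"
  \<comment> \<open>At least 4 of 7 vertices lie outside each facet, so the size bound would give 8
    \<le> 7. Weight 4 is admissible because \<open>4 \<le> m\<close>.\<close>
  then obtain W :: "'v set" where W: "card W = 7"
    using obtain_subset_with_card_n[of 7 "UNIV :: 'v set"] assms by auto
  have "covers \<Delta> (card W - 3) (\<lambda>v. of_bool (v \<in> W))"
    by (rule covers_indicator) (rule card_facet_Int)
  moreover obtain e where "e \<notin> \<Delta>" "card e = 2" using ex_nonedge assms by blast
  ultimately show False using nonedge_size_bound[of e] W m by fastforce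
qed

text \<open>A facet contains at most one of three pairwise nonadjacent vertices, so their indicator
  has weight at least 2 outside every facet, and the size bound would give 4 \<le> 3.\<close>

lemma no_nonedge_triangle:
  assumes "x \<noteq> y" "x \<noteq> z" "y \<noteq> z" "{x, y} \<notin> \<Delta>" "{x, z} \<notin> \<Delta>"
  shows "{y, z} \<in> \<Delta>"
proof (rule ccontr)
  assume yz: "{y, z} \<notin> \<Delta>"
  let ?W = "{x, y, z}"
  have "card (F \<inter> ?W) \<le> 1" if F: "F \<in> facets \<Delta>" for F
  proof -
    have "{u, v} \<in> \<Delta>" if "u \<in> F" "v \<in> F" for u v
      using that down[OF facet_face[OF F]] by simp
    then have "F \<inter> ?W \<subseteq> {x} \<or> F \<inter> ?W \<subseteq> {y} \<or> F \<inter> ?W \<subseteq> {z}"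
      using assms yz by blast
    then show ?thesis
      using card_mono[of "{_}" "F \<inter> ?W"] by fastforce
  qed
  from covers_indicator[of ?W 1, OF this] have "covers \<Delta> (card ?W - 1) (\<lambda>v. of_bool (v \<in> ?W))" .
  moreover have "card ?W - 1 = 2" using assms by simp
  ultimately have "covers \<Delta> 2 (\<lambda>v. of_bool (v \<in> ?W))" by metis
  moreover have "(\<Sum>v\<in>UNIV. of_bool (v \<in> ?W)) = card ?W"
    by (simp only: sum_of_bool_eq finite Collect_mem_eq Int_UNIV_left of_nat_id)
  ultimately have "2 * 2 \<le> card ?W"
    using nonedge_size_bound[OF yz, of 2 "\<lambda>v. of_bool (v \<in> ?W)"] card_2_iff[of "{y, z}"] assms(3) m
    by fastforce
  then show False using assms by simp
qed

text \<open>The exponent vector has total degree \<open>2 * m\<close>, so \<open>m\<close> nonfaces packed into it must all be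
  edges and exhaust it.\<close>

lemma perfect_packing:
  assumes n: "CARD('v) = 6" and e: "e \<notin> \<Delta>" "card e = 2"
  obtains G where "\<And>i. i < m \<Longrightarrow> G i \<notin> \<Delta>" "\<And>i. i < m \<Longrightarrow> card (G i) = 2"
    "\<And>v. (\<Sum>i<m. of_bool (v \<in> G i)) = 1 + (m - 3) * of_bool (v \<in> e)"
proof -
  \<comment> \<open>On six vertices the all-ones vector has weight 3 outside every facet;
    \<open>m - 3\<close> copies of \<open>e\<close> lift this to \<open>m\<close>.\<close>
  let ?a = "\<lambda>v. 1 + (m - 3) * of_bool (v \<in> e)"
  have "covers \<Delta> (card (UNIV :: 'v set) - 3) (\<lambda>v. of_bool (v \<in> UNIV))"
    by (rule covers_indicator) (simp add: card_facet)
  then have "covers \<Delta> 3 (\<lambda>v. 1)" using n by simp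
  from covers_add_copies[OF this e(1), of "m - 3"] have "packs \<Delta> m ?a"
    using m eq down by simp
  then obtain G where G: "\<And>i. i < m \<Longrightarrow> G i \<notin> \<Delta>" "\<And>v. (\<Sum>i<m. of_bool (v \<in> G i)) \<le> ?a v"
    unfolding packs_def by blast
  have a: "(\<Sum>v\<in>UNIV. ?a v) = (\<Sum>i<m. 2)"
    unfolding sum.distrib sum_distrib_left[symmetric] using n e m by (simp add: Int_def)
  have s: "(\<Sum>v\<in>UNIV. \<Sum>i<m. of_bool (v \<in> G i)) = (\<Sum>i<m. card (G i))"
    using sum_count_swap[of UNIV G m] by simp
  have "(\<Sum>v\<in>UNIV. \<Sum>i<m. of_bool (v \<in> G i)) \<le> (\<Sum>v\<in>UNIV. ?a v)"
    by (rule sum_mono) (rule G(2))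
  moreover have ge: "(\<Sum>i<m. 2) \<le> (\<Sum>i<m. card (G i))"
    by (rule sum_mono) (use G(1) card_nonface in auto)
  ultimately have "(\<Sum>i<m. 2) = (\<Sum>i<m. card (G i))"
    "(\<Sum>v\<in>UNIV. \<Sum>i<m. of_bool (v \<in> G i)) = (\<Sum>v\<in>UNIV. ?a v)"
    using a s by linarith+
  note sums = this
  \<comment> \<open>Termwise inequalities between equal sums are equalities.\<close>
  have "2 = card (G i)" if "i < m" for i
    by (rule sum_mono_inv[OF sums(1)]) (use that G(1) card_nonface in auto)
  moreover have "(\<Sum>i<m. of_bool (v \<in> G i)) = ?a v" for v
    by (rule sum_mono_inv[OF sums(2)]) (simp_all only: G(2) UNIV_I finite)
  ultimately show thesis using that[of G] G(1) by simp
qed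

text \<open>Every vertex has positive weight in a perfect packing, so some packed nonedge contains
  \<open>x\<close>. As singletons are faces, \<open>y\<close> differs from \<open>x\<close>.\<close>

lemma ex_nonneighbour:
  assumes "CARD('v) = 6"
  shows "\<exists>y. {x, y} \<notin> \<Delta>"
proof -
  obtain e where e: "e \<notin> \<Delta>" "card e = 2" using ex_nonedge assms by auto
  obtain G where G: "\<And>i. i < m \<Longrightarrow> G i \<notin> \<Delta>" "\<And>i. i < m \<Longrightarrow> card (G i) = 2"
    "\<And>v. (\<Sum>i<m. of_bool (v \<in> G i)) = 1 + (m - 3) * of_bool (v \<in> e)"
    using perfect_packing[OF assms e] by blast
  have "(\<Sum>i<m. of_bool (x \<in> G i) :: nat) \<noteq> 0" by (subst G(3)) simp
  then obtain i where i: "i < m" "x \<in> G i" 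
    by (metis (no_types, lifting) lessThan_iff of_bool_eq_0_iff sum.neutral)
  then obtain y where "G i = {x, y}" using G(2)[of i] by (auto simp: card_2_iff doubleton_eq_iff)
  then show ?thesis using G(1) i by metis
qed

text \<open>Hall's condition for the nonedges between a face and its complement, obtained by
  counting how often the sets of a perfect packing meet \<open>X\<close> and
  \<open>?N\<close>.\<close>

lemma hall_condition:
  assumes n: "CARD('v) = 6" and F: "F \<in> \<Delta>" and X: "X \<subseteq> F" "X \<noteq> {}"
  shows "card X \<le> card {y. \<exists>x\<in>X. {x, y} \<notin> \<Delta>}" (is "_ \<le> card ?N")
proof -
  have "y \<notin> F" if "{x, y} \<notin> \<Delta>" "x \<in> F" for x y
    using that down[OF F, of "{x, y}"] by blast
  then have disj: "X \<inter> ?N = {}" using X(1) by blast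
  txt \<open>The repeated nonedge meets both \<open>X\<close> and its neighbourhood in one vertex, so the repetitions
    contribute equally to both sides of the count.\<close>
  obtain x y where x: "x \<in> X" and xy: "{x, y} \<notin> \<Delta>"
    using X ex_nonneighbour[OF n] by blast
  then have y: "y \<in> ?N" by blast
  let ?e = "{x, y}"
  have "x \<noteq> y" using x y disj by blast
  then have ce: "card ?e = 2" by simp
  obtain G where G: "\<And>i. i < m \<Longrightarrow> G i \<notin> \<Delta>" "\<And>i. i < m \<Longrightarrow> card (G i) = 2"
    "\<And>v. (\<Sum>i<m. of_bool (v \<in> G i)) = 1 + (m - 3) * of_bool (v \<in> ?e)"
    using perfect_packing[OF n xy ce] by blast
  have count: "(\<Sum>i<m. card (G i \<inter> A)) = card A + (m - 3) * card (A \<inter> ?e)" for A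
  proof -
    have "(\<Sum>i<m. card (G i \<inter> A)) = (\<Sum>v\<in>A. 1 + (m - 3) * of_bool (v \<in> ?e))"
      by (subst sum_count_swap[symmetric]) (simp_all only: G(3) finite)
    also have "\<dots> = card A + (m - 3) * card (A \<inter> ?e)"
      by (simp only: sum.distrib sum_distrib_left[symmetric] sum_of_bool_eq finite Collect_mem_eq
          of_nat_id card_eq_sum)
    finally show ?thesis .
  qed
  \<comment> \<open>A packed nonedge meets \<open>X\<close> at most once, since \<open>X\<close>
    lies in a face, and its other end is then in \<open>?N\<close>.\<close>
  have "card (G i \<inter> X) \<le> card (G i \<inter> ?N)" if i: "i < m" for i
  proof -
    obtain p q where pq: "G i = {p, q}" "p \<noteq> q"
      using G(2)[OF i] by (auto simp: card_2_iff)
    have "{p, q} \<notin> \<Delta>" "{q, p} \<notin> \<Delta>" using G(1)[OF i] pq by (auto simp: insert_commute)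
    then have N: "p \<in> X \<Longrightarrow> q \<in> ?N" "q \<in> X \<Longrightarrow> p \<in> ?N" by blast+
    show ?thesis
    proof (cases "p \<in> X \<or> q \<in> X")
      case True
      then have "G i \<inter> X = {p} \<and> q \<in> ?N \<or> G i \<inter> X = {q} \<and> p \<in> ?N"
      proof
        assume "p \<in> X"
        moreover from this have "q \<notin> X" using N(1) disj by blast
        ultimately show ?thesis using N(1) unfolding pq(1) by blast
      next
        assume "q \<in> X"
        moreover from this have "p \<notin> X" using N(2) disj by blast
        ultimately show ?thesis using N(2) unfolding pq(1) by blast
      qed
      then have "card (G i \<inter> X) = 1" "G i \<inter> ?N \<noteq> {}" unfolding pq(1) by auto
      moreover from this(2) have "0 < card (G i \<inter> ?N)" unfolding card_gt_0_iff by simp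
      ultimately show ?thesis by linarith
    next
      case False
      then show ?thesis using pq by simp
    qed
  qed
  then have "(\<Sum>i<m. card (G i \<inter> X)) \<le> (\<Sum>i<m. card (G i \<inter> ?N))"
    by (intro sum_mono) simp
  moreover have "X \<inter> ?e = {x}" "?N \<inter> ?e = {y}"
    using x y disj by blast+
  ultimately show ?thesis
    unfolding count by simp
qed

text \<open>Hall's theorem matches the vertices of a facet with distinct nonneighbours. These lie
  outside the facet, which contains no nonedge, and so the six vertices are used up.\<close>

lemma nonedge_matching:
  assumes n: "CARD('v) = 6"
  obtains a b c a' b' c' where "UNIV = {a, b, c, a', b', c'}" "distinct [a, b, c, a', b', c']"
    "{a, b, c} \<in> facets \<Delta>" "{a, a'} \<notin> \<Delta>" "{b, b'} \<notin> \<Delta>" "{c, c'} \<notin> \<Delta>"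
proof -
  obtain F where F: "F \<in> facets \<Delta>" using ex_facet[OF vertex] .
  then obtain a b c where abc: "F = {a, b, c}" "distinct [a, b, c]"
    using card_facet[OF F] by (auto simp: card_3_iff)
  let ?N = "\<lambda>x. {y. {x, y} \<notin> \<Delta>}"
  have F\<Delta>: "{a, b, c} \<in> \<Delta>" using F abc facet_face by simp
  note hall = hall_condition[OF n F\<Delta>]
  have h1: "\<exists>y. y \<in> ?N x" for x using ex_nonneighbour[OF n] by simp
  have h2: "\<exists>y. y \<in> ?N u \<union> ?N v \<and> y \<noteq> x" if "u \<noteq> v" "{u, v} \<subseteq> {a, b, c}" for u v x
  proof (rule ccontr)
    assume "\<not> ?thesis"
    then have "{y. \<exists>x\<in>{u, v}. {x, y} \<notin> \<Delta>} \<subseteq> {x}" by blast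
    from card_mono[OF _ this] hall[of "{u, v}"] that show False by simp
  qed
  have h3: "\<exists>z. z \<in> ?N a \<union> ?N b \<union> ?N c \<and> z \<noteq> x \<and> z \<noteq> y" for x y
  proof (rule ccontr)
    assume "\<not> ?thesis"
    then have "{y. \<exists>x\<in>{a, b, c}. {x, y} \<notin> \<Delta>} \<subseteq> {x, y}" by blast
    from card_mono[OF _ this] hall[of "{a, b, c}"] abc(2) show False
      by (simp add: card_insert_if split: if_splits)
  qed
  obtain a' b' c' where N: "{a, a'} \<notin> \<Delta>" "{b, b'} \<notin> \<Delta>" "{c, c'} \<notin> \<Delta>"
    and d: "a' \<noteq> b'" "a' \<noteq> c'" "b' \<noteq> c'"
    using distinct_representatives_3[of "?N a" "?N b" "?N c"] h1 h2 h3 abc(2) by auto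
  have "z \<notin> {a, b, c}" if "{u, z} \<notin> \<Delta>" "u \<in> {a, b, c}" for u z
    using that down[OF F\<Delta>, of "{u, z}"] by blast
  then have "a' \<notin> {a, b, c}" "b' \<notin> {a, b, c}" "c' \<notin> {a, b, c}" using N by blast+
  then have D: "distinct [a, b, c, a', b', c']" using abc(2) d by auto
  then have "card {a, b, c, a', b', c'} = 6" by simp
  then have "{a, b, c, a', b', c'} = UNIV" using n by (intro card_subset_eq) auto
  then show thesis using that[OF _ D _ N] F abc by simp
qed

text \<open>The antipode of the facet is not a triangle here. Instead the facet with
  \<open>b'\<close> in place of \<open>b\<close>, or with both \<open>b'\<close> and
  \<open>c'\<close> in place of \<open>b\<close> and \<open>c\<close>, turns out to be a triangle
  together with its antipode.\<close>

lemma disjoint_triangles_swap: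
  assumes U: "UNIV = {a, b, c, a', b', c'}" and D: "distinct [a, b, c, a', b', c']"
    and F: "{a, b, c} \<in> facets \<Delta>"
    and M: "{a, a'} \<notin> \<Delta>" "{b, b'} \<notin> \<Delta>" "{c, c'} \<notin> \<Delta>"
    and ab: "{a', b'} \<notin> \<Delta>"
  shows "\<exists>T1 T2. triangle (skeleton1 \<Delta>) T1 \<and> triangle (skeleton1 \<Delta>) T2 \<and> T1 \<inter> T2 = {}"
proof -
  define E where "E x y \<longleftrightarrow> {x, y} \<in> \<Delta>" for x y
  have sym: "E x y \<longleftrightarrow> E y x" for x y
    by (simp add: E_def insert_commute)
  have tri: "E x y \<or> E x z \<or> E y z" if "distinct [x, y, z]" for x y z
    unfolding E_def using no_nonedge_triangle that by auto
  have in_facet: "E x y" if "K \<in> facets \<Delta>" "x \<in> K" "y \<in> K" for K x y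
    unfolding E_def using that(2,3) down[OF facet_face[OF that(1)], of "{x, y}"] by simp
  have transversal: "(a \<in> K \<or> a' \<in> K) \<and> (b \<in> K \<or> b' \<in> K) \<and> (c \<in> K \<or> c' \<in> K)"
    if K: "K \<in> facets \<Delta>" for K
  proof -
    have U': "{a, a'} \<union> {b, b'} \<union> {c, c'} = UNIV" unfolding U by blast
    have "card {a, a'} = 2" "card {b, b'} = 2" "card {c, c'} = 2" using D by auto
    then have "card (K \<inter> {a, a'}) = 1" "card (K \<inter> {b, b'}) = 1" "card (K \<inter> {c, c'}) = 1"
      using facet_transversal[OF U' M _ _ _ K] by blast+
    then have "K \<inter> {a, a'} \<noteq> {}" "K \<inter> {b, b'} \<noteq> {}" "K \<inter> {c, c'} \<noteq> {}"
      by (metis card.empty zero_neq_one)+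
    then show ?thesis by blast
  qed
  \<comment> \<open>The rest is propositional in \<open>E\<close>: the known nonedges, the edges of
    the given facet, an edge in certain triples, and a facet through each of \<open>a'\<close>,
    \<open>b'\<close>, \<open>c'\<close>.\<close>
  have "\<not> E a a'" "\<not> E b b'" "\<not> E c c'" "\<not> E a' b'"
    using M ab by (simp_all add: E_def)
  moreover have "E a b" "E a c" "E b c"
    using in_facet[OF F] by auto
  moreover have "E a a' \<or> E a b' \<or> E a' b'" "E b b' \<or> E a' b \<or> E a' b'"
      "E a' b' \<or> E a' c' \<or> E b' c'" "E a' b' \<or> E a' c \<or> E b' c"
    using tri[of a a' b'] tri[of b b' a'] tri[of a' b' c'] tri[of a' b' c] D sym by auto
  \<comment> \<open>The last alternative accounts for facets through both \<open>a'\<close> and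
    \<open>b'\<close>; it is ruled out by \<open>ab\<close>.\<close>
  moreover have "E a' b \<and> (E a' c \<and> E b c \<or> E a' c' \<and> E b c') \<or> E a' b'"
  proof -
    obtain K where K: "K \<in> facets \<Delta>" "{a'} \<subseteq> K" using ex_facet[OF vertex] .
    then show ?thesis using transversal[OF K(1)] in_facet[OF K(1)] by blast
  qed
  moreover have "E a b' \<and> (E b' c \<and> E a c \<or> E b' c' \<and> E a c') \<or> E a' b'"
  proof -
    obtain K where K: "K \<in> facets \<Delta>" "{b'} \<subseteq> K" using ex_facet[OF vertex] .
    then show ?thesis using transversal[OF K(1)] in_facet[OF K(1)] by blast
  qed
  moreover have "E a c' \<and> E b c' \<or> E a c' \<and> E b' c' \<or> E a' c' \<and> E b c' \<or> E a' b'"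
  proof -
    obtain K where K: "K \<in> facets \<Delta>" "{c'} \<subseteq> K" using ex_facet[OF vertex] .
    then show ?thesis using transversal[OF K(1)] in_facet[OF K(1)] by blast
  qed
  ultimately have *: "(E a' b \<and> E a' c \<and> E b c) \<and> (E a b' \<and> E a c' \<and> E b' c')
      \<or> (E a' b \<and> E a' c' \<and> E b c') \<and> (E a b' \<and> E a c \<and> E b' c)"
    by blast
  have T: "triangle (skeleton1 \<Delta>) {x, y, z}" if "distinct [x, y, z]" "E x y \<and> E x z \<and> E y z" for x y z
    using that sym unfolding triangle_def skeleton1_def E_def by (auto simp: insert_commute)
  from * show ?thesis
  proof
    assume "(E a' b \<and> E a' c \<and> E b c) \<and> (E a b' \<and> E a c' \<and> E b' c')"
    then have "triangle (skeleton1 \<Delta>) {a', b, c}" "triangle (skeleton1 \<Delta>) {a, b', c'}"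
      using T[of a' b c] T[of a b' c'] D by auto
    moreover have "{a', b, c} \<inter> {a, b', c'} = {}" using D by auto
    ultimately show ?thesis by blast
  next
    assume "(E a' b \<and> E a' c' \<and> E b c') \<and> (E a b' \<and> E a c \<and> E b' c)"
    then have "triangle (skeleton1 \<Delta>) {a', b, c'}" "triangle (skeleton1 \<Delta>) {a, b', c}"
      using T[of a' b c'] T[of a b' c] D by auto
    moreover have "{a', b, c'} \<inter> {a, b', c} = {}" using D by auto
    ultimately show ?thesis by blast
  qed
qed

lemma necessary:
  assumes "6 \<le> CARD('v)"
  shows "CARD('v) = 6"
    and "\<exists>e1 e2 e3. {e1, e2, e3} \<subseteq> complement_graph (skeleton1 \<Delta>)
          \<and> e1 \<inter> e2 = {} \<and> e1 \<inter> e3 = {} \<and> e2 \<inter> e3 = {}"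
    and "\<exists>T1 T2. triangle (skeleton1 \<Delta>) T1 \<and> triangle (skeleton1 \<Delta>) T2 \<and> T1 \<inter> T2 = {}"
proof -
  show n: "CARD('v) = 6" by (rule card_vertices[OF assms])
  obtain a b c a' b' c' where U: "UNIV = {a, b, c, a', b', c'}"
    and D: "distinct [a, b, c, a', b', c']" and F: "{a, b, c} \<in> facets \<Delta>"
    and M: "{a, a'} \<notin> \<Delta>" "{b, b'} \<notin> \<Delta>" "{c, c'} \<notin> \<Delta>"
    using nonedge_matching[OF n] .
  have "{{a, a'}, {b, b'}, {c, c'}} \<subseteq> complement_graph (skeleton1 \<Delta>)"
    using M D by (auto simp: complement_graph_def skeleton1_def)
  moreover have "{a, a'} \<inter> {b, b'} = {}" "{a, a'} \<inter> {c, c'} = {}" "{b, b'} \<inter> {c, c'} = {}"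
    using D by auto
  ultimately show "\<exists>e1 e2 e3. {e1, e2, e3} \<subseteq> complement_graph (skeleton1 \<Delta>)
          \<and> e1 \<inter> e2 = {} \<and> e1 \<inter> e3 = {} \<and> e2 \<inter> e3 = {}"
    by blast
  \<comment> \<open>Either the antipode of the facet is a triangle, or relabelling moves a nonedge
    inside it to the position of \<open>a'\<close>, \<open>b'\<close>.\<close>
  consider "{a', b'} \<notin> \<Delta>" | "{a', c'} \<notin> \<Delta>" | "{b', c'} \<notin> \<Delta>"
    | "{a', b'} \<in> \<Delta>" "{a', c'} \<in> \<Delta>" "{b', c'} \<in> \<Delta>"
    by blast
  then show "\<exists>T1 T2. triangle (skeleton1 \<Delta>) T1 \<and> triangle (skeleton1 \<Delta>) T2 \<and> T1 \<inter> T2 = {}"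
  proof cases
    case 1
    show ?thesis by (rule disjoint_triangles_swap[OF U D F M 1])
  next
    case 2
    show ?thesis
      by (rule disjoint_triangles_swap[of a c b a' c' b', OF _ _ _ M(1,3,2) 2])
        (use U D F in \<open>auto simp: insert_commute\<close>)
  next
    case 3
    show ?thesis
      by (rule disjoint_triangles_swap[of b c a b' c' a', OF _ _ _ M(2,3,1) 3])
        (use U D F in \<open>auto simp: insert_commute\<close>)
  next
    case 4
    then have "triangle (skeleton1 \<Delta>) {a', b', c'}"
      using D by (auto simp: triangle_def skeleton1_def insert_commute)
    moreover have "{a, b} \<in> \<Delta>" "{a, c} \<in> \<Delta>" "{b, c} \<in> \<Delta>"
      using down[OF facet_face[OF F]] by simp_all
    then have "triangle (skeleton1 \<Delta>) {a, b, c}"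
      using D by (auto simp: triangle_def skeleton1_def insert_commute)
    moreover have "{a, b, c} \<inter> {a', b', c'} = {}" using D by auto
    ultimately show ?thesis by blast
  qed
qed

end

section \<open>Equality of all powers\<close>

text \<open>If the three vertices do not form a face, every edge among them lies in a facet missing
  the third vertex, which must then carry weight \<open>m\<close>. The nonedges present decide which
  sets are packed.\<close>

lemma packs_on_three_vertices:
  assumes D: "distinct [p, q, r]" and pq: "{p, q} \<in> \<Delta>"
    and supp: "\<And>v. v \<notin> {p, q, r} \<Longrightarrow> a v = 0" and a: "covers \<Delta> m a"
  shows "packs \<Delta> m a"
proof (cases "{p, q, r} \<in> \<Delta>")
  case True
  then have "{p, q, r} \<in> facets \<Delta>" using D by (intro face_card_3_facet) auto
  \<comment> \<open>This facet contains the whole support, so \<open>m\<close> is 0 and the empty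
    packing suffices.\<close>
  then have "m \<le> (\<Sum>v\<in>-{p, q, r}. a v)" using a by (auto simp: covers_def)
  also have "\<dots> = 0" using supp by simp
  finally show ?thesis by (simp add: packs_def)
next
  case False
  have edge: "m \<le> a z" if xy: "{x, y} \<in> \<Delta>" and xyz: "{x, y, z} = {p, q, r}" for x y z
  proof -
    obtain F where F: "F \<in> facets \<Delta>" "{x, y} \<subseteq> F" using ex_facet[OF xy] .
    have "\<not> {p, q, r} \<subseteq> F" using False down[OF facet_face[OF F(1)]] by blast
    then have "z \<notin> F" using F(2) unfolding xyz[symmetric] by blast
    have "a v = 0" if "v \<in> -F - {z}" for v
    proof -
      have "v \<notin> {x, y, z}" using that F(2) by blast
      then show ?thesis using supp[of v] unfolding xyz by blast
    qed
    then have "(\<Sum>v\<in>-F. a v) = (\<Sum>v\<in>{z}. a v)"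
      by (intro sum.mono_neutral_right) (use \<open>z \<notin> F\<close> in auto)
    moreover have "m \<le> (\<Sum>v\<in>-F. a v)" using a F by (auto simp: covers_def)
    ultimately show ?thesis by simp
  qed
  have r: "m \<le> a r" using edge[OF pq] by blast
  have q: "m \<le> a q" if "{p, r} \<in> \<Delta>" using edge[OF that] by blast
  have p: "m \<le> a p" if "{q, r} \<in> \<Delta>" using edge[OF that] by blast
  consider "{p, r} \<in> \<Delta>" "{q, r} \<in> \<Delta>" | "{p, r} \<in> \<Delta>" "{q, r} \<notin> \<Delta>"
    | "{p, r} \<notin> \<Delta>" "{q, r} \<in> \<Delta>" | "{p, r} \<notin> \<Delta>" "{q, r} \<notin> \<Delta>"
    by blast
  then show ?thesis
  proof cases
    case 1
    \<comment> \<open>All three pairs are edges, and the nonface \<open>{p, q, r}\<close> itself is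
      packed \<open>m\<close> times.\<close>
    then show ?thesis using packs_const[OF False] p q r by auto
  next
    case 2
    then show ?thesis using packs_const[of "{q, r}" \<Delta> m a] q r by auto
  next
    case 3
    then show ?thesis using packs_const[of "{p, r}" \<Delta> m a] p r by auto
  next
    case 4
    \<comment> \<open>A facet through \<open>r\<close> avoids \<open>p\<close> and \<open>q\<close>,
      so these two carry weight \<open>m\<close> jointly.\<close>
    obtain F where F: "F \<in> facets \<Delta>" "{r} \<subseteq> F" using ex_facet[OF vertex] .
    have "p \<notin> F" "q \<notin> F"
      using F 4 down[OF facet_face[OF F(1)], of "{p, r}"] down[OF facet_face[OF F(1)], of "{q, r}"] by auto
    have "m \<le> (\<Sum>v\<in>-F. a v)" using a F by (auto simp: covers_def)
    also have "\<dots> = (\<Sum>v\<in>{p, q}. a v)"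
    proof (rule sum.mono_neutral_right)
      have "v \<notin> {p, q, r}" if "v \<in> -F - {p, q}" for v
        using that F(2) by blast
      then show "\<forall>v\<in>-F - {p, q}. a v = 0" using supp by blast
    qed (use \<open>p \<notin> F\<close> \<open>q \<notin> F\<close> in auto)
    finally have pq: "m \<le> a p + a q" using D by simp
    \<comment> \<open>The first \<open>a p\<close> sets use up \<open>p\<close>, at most
      \<open>a q\<close> sets remain for \<open>q\<close>, and \<open>r\<close> lies in all
      \<open>m\<close> of them.\<close>
    let ?G = "\<lambda>i. if i < a p then {p, r} else {q, r}"
    have "(\<Sum>i<m. of_bool (v \<in> ?G i)) \<le> a v" for v
    proof -
      consider "v = r" | "v = p" | "v = q" | "v \<notin> {p, q, r}" by blast
      then have le: "card {i. i < m \<and> v \<in> ?G i} \<le> a v"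
      proof cases
        case 1
        then have "{i. i < m \<and> v \<in> ?G i} = {..<m}" by auto
        then show ?thesis using 1 r by simp
      next
        case 2
        then have "{i. i < m \<and> v \<in> ?G i} \<subseteq> {..<a p}" using D by auto
        from card_mono[OF _ this] show ?thesis using 2 by simp
      next
        case 3
        then have "{i. i < m \<and> v \<in> ?G i} \<subseteq> {a p..<m}" using D by auto
        from card_mono[OF _ this] show ?thesis using 3 pq by simp
      next
        case 4
        then have "{i. i < m \<and> v \<in> ?G i} = {}" by auto
        then show ?thesis by (simp only: card.empty)
      qed
      have "(\<Sum>i<m. of_bool (v \<in> ?G i)) = card {i. i < m \<and> v \<in> ?G i}"
        by (simp only: sum_of_bool_eq finite_lessThan Int_def lessThan_iff mem_Collect_eq of_nat_id)
      then show ?thesis using le by simp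
    qed
    then show ?thesis unfolding packs_def using 4 by (intro exI[of _ ?G]) auto
  qed
qed

text \<open>Induction on \<open>m\<close>: a matching nonedge inside the support is removed; once
  there is none, the support lies in a transversal and \<open>packs_on_three_vertices\<close>
  applies.\<close>

lemma sufficient:
  assumes n: "CARD('v) = 6"
    and e: "{e1, e2, e3} \<subseteq> complement_graph (skeleton1 \<Delta>)" "e1 \<inter> e2 = {}" "e1 \<inter> e3 = {}" "e2 \<inter> e3 = {}"
    and T: "triangle (skeleton1 \<Delta>) T1" "triangle (skeleton1 \<Delta>) T2" "T1 \<inter> T2 = {}"
    and a: "covers \<Delta> m a"
  shows "packs \<Delta> m a"
proof -
  have e': "e1 \<notin> \<Delta>" "e2 \<notin> \<Delta>" "e3 \<notin> \<Delta>" and card_e: "card e1 = 2" "card e2 = 2" "card e3 = 2"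
    using e(1) by (auto simp: complement_graph_def skeleton1_def)
  have "card (e1 \<union> e2 \<union> e3) = 6"
    using e(2-4) card_e by (simp add: card_Un_disjoint Int_Un_distrib2)
  then have U: "e1 \<union> e2 \<union> e3 = UNIV"
    using n by (intro card_subset_eq) auto
  have "card (T1 \<union> T2) = 6"
    using T by (simp add: card_Un_disjoint triangle_def)
  then have UT: "T1 \<union> T2 = UNIV"
    using n by (intro card_subset_eq) auto
  have T_edge: "{x, y} \<in> \<Delta>" if "x \<in> T1 \<and> y \<in> T1 \<or> x \<in> T2 \<and> y \<in> T2" "x \<noteq> y" for x y
    using that T(1,2) by (auto simp: triangle_def skeleton1_def)
  \<comment> \<open>By the pigeonhole principle two of the three vertices lie in the same
    triangle.\<close>
  have edge: "{x, y} \<in> \<Delta> \<or> {x, z} \<in> \<Delta> \<or> {y, z} \<in> \<Delta>" if "distinct [x, y, z]" for x y z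
    using that T_edge[of x y] T_edge[of x z] T_edge[of y z] UT by auto
  show ?thesis
    using a
  proof (induction m arbitrary: a)
    case 0
    then show ?case by (simp add: packs_def)
  next
    case (Suc m)
    show ?case
    proof (cases "\<exists>e\<in>{e1, e2, e3}. \<forall>v\<in>e. 1 \<le> a v")
      case True
      txt \<open>Every facet meets \<open>e\<close> in exactly one vertex, so removing \<open>e\<close> costs each cover exactly 1.\<close>
      then obtain e where e: "e \<in> {e1, e2, e3}" "\<And>v. v \<in> e \<Longrightarrow> 1 \<le> a v" by blast
      have "covers \<Delta> m (\<lambda>v. a v - of_bool (v \<in> e))"
        unfolding covers_def
      proof
        fix F assume F: "F \<in> facets \<Delta>"
        have "card (F \<inter> e) = 1" and ce: "card e = 2"
          using facet_transversal[OF U e' card_e F] card_e e(1) by auto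
        moreover have "card e = card (F \<inter> e) + card (-F \<inter> e)"
          by (subst card_Un_disjoint[symmetric]) (auto intro: arg_cong[where f = card])
        ultimately have "card (-F \<inter> e) = 1" by simp
        then have "1 = (\<Sum>v\<in>-F. of_bool (v \<in> e) :: nat)" by (simp add: Int_def)
        moreover have "Suc m \<le> (\<Sum>v\<in>-F. a v)" using Suc.prems F by (auto simp: covers_def)
        moreover have "(\<Sum>v\<in>-F. a v) = (\<Sum>v\<in>-F. (a v - of_bool (v \<in> e)) + of_bool (v \<in> e))"
          by (rule sum.cong) (use e(2) in \<open>auto simp: of_bool_def\<close>)
        ultimately show "m \<le> (\<Sum>v\<in>-F. a v - of_bool (v \<in> e))"
          unfolding sum.distrib by linarith
      qed
      then have "packs \<Delta> m (\<lambda>v. a v - of_bool (v \<in> e))" by (rule Suc.IH)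
      then show ?thesis using packs_Suc[of e \<Delta> a m] e e' by blast
    next
      case False
      \<comment> \<open>Each matching nonedge has a vertex of weight 0; the chosen \<open>p\<close>
        is the other one, arbitrary if both have weight 0.\<close>
      have "\<exists>p\<in>e. \<forall>v\<in>e. v \<noteq> p \<longrightarrow> a v = 0" if "e \<in> {e1, e2, e3}" for e
      proof -
        have "card e = 2" using that card_e by auto
        then obtain x y where "e = {x, y}" by (auto simp: card_2_iff)
        then show ?thesis using False that by fastforce
      qed
      then obtain p q r where p: "p \<in> e1" "\<And>v. v \<in> e1 \<Longrightarrow> v \<noteq> p \<Longrightarrow> a v = 0"
        and q: "q \<in> e2" "\<And>v. v \<in> e2 \<Longrightarrow> v \<noteq> q \<Longrightarrow> a v = 0"
        and r: "r \<in> e3" "\<And>v. v \<in> e3 \<Longrightarrow> v \<noteq> r \<Longrightarrow> a v = 0"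
        by (metis insertI1 insertI2)
      have D: "distinct [p, q, r]" using p(1) q(1) r(1) e by auto
      have supp: "a v = 0" if "v \<notin> {p, q, r}" for v
        using that p(2)[of v] q(2)[of v] r(2)[of v] U by auto
      from edge[OF D] show ?thesis
      proof (elim disjE)
        assume "{p, q} \<in> \<Delta>"
        from packs_on_three_vertices[OF D this supp Suc.prems] show ?thesis .
      next
        assume "{p, r} \<in> \<Delta>"
        then show ?thesis
          using packs_on_three_vertices[of p r q a "Suc m"] D supp Suc.prems by auto
      next
        assume "{q, r} \<in> \<Delta>"
        then show ?thesis
          using packs_on_three_vertices[of q r p a "Suc m"] D supp Suc.prems by auto
      qed
    qed
  qed
qed

end

text \<open>A face of the maximal dimension 2 is a facet, and purity passes its size on to all
  facets.\<close>

lemma pure_two_dim_complex_if: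
  fixes \<Delta> :: "'v::finite set set"
  assumes "simplicial_complex \<Delta>" "pure \<Delta>" "complex_dim \<Delta> = 2"
  shows "pure_two_dim_complex \<Delta>"
proof
  show down: "G \<in> \<Delta>" if "F \<in> \<Delta>" "G \<subseteq> F" for F G
    using assms(1) that by (auto simp: simplicial_complex_def)
  show v: "{v} \<in> \<Delta>" for v
    using assms(1) by (auto simp: simplicial_complex_def)
  have "complex_dim \<Delta> \<in> face_dim ` \<Delta>"
    unfolding complex_dim_def using v by (intro Max_in) auto
  then obtain H where H: "H \<in> \<Delta>" "face_dim H = 2" using assms(3) by auto
  have le: "face_dim F \<le> 2" if "F \<in> \<Delta>" for F
    using that assms(3) unfolding complex_dim_def by (metis Max_ge finite finite_imageI imageI)
  have "G = H" if "G \<in> \<Delta>" "H \<subseteq> G" for G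
    using that H(2) le[of G] card_seteq[of G H] by (simp add: face_dim_def)
  then have "H \<in> facets \<Delta>" using H by (auto simp: facets_def)
  then have "face_dim F = face_dim H" if "F \<in> facets \<Delta>" for F
    using assms(2) that unfolding pure_def by blast
  then show "card F = 3" if "F \<in> facets \<Delta>" for F
    using that H(2) by (simp add: face_dim_def)
qed

theorem theorem2p6:
  fixes \<Delta> :: "'v::finite set set"
  assumes "simplicial_complex \<Delta>"
    and "pure \<Delta>"
    and "complex_dim \<Delta> = 2"
    and "CARD('v) \<ge> 6"
  shows "((\<exists>m\<ge>4. (SR_symbolic_power \<Delta> m :: ('v, 'k::field) mpoly set) = ideal_power (SR_ideal \<Delta>) m)
          \<longleftrightarrow> (\<forall>m\<ge>1. (SR_symbolic_power \<Delta> m :: ('v, 'k) mpoly set) = ideal_power (SR_ideal \<Delta>) m))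
       \<and> ((\<forall>m\<ge>1. (SR_symbolic_power \<Delta> m :: ('v, 'k) mpoly set) = ideal_power (SR_ideal \<Delta>) m)
          \<longleftrightarrow> CARD('v) = 6
            \<and> (\<exists>e1 e2 e3. {e1, e2, e3} \<subseteq> complement_graph (skeleton1 \<Delta>)
                 \<and> e1 \<inter> e2 = {} \<and> e1 \<inter> e3 = {} \<and> e2 \<inter> e3 = {})
            \<and> (\<exists>T1 T2. triangle (skeleton1 \<Delta>) T1 \<and> triangle (skeleton1 \<Delta>) T2 \<and> T1 \<inter> T2 = {}))"
    (is "((\<exists>m\<ge>4. ?eq m) \<longleftrightarrow> (\<forall>m\<ge>1. ?eq m)) \<and> ((\<forall>m\<ge>1. ?eq m) \<longleftrightarrow> ?n \<and> ?M \<and> ?T)")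
proof -
  interpret pure_two_dim_complex \<Delta>
    using assms(1-3) by (rule pure_two_dim_complex_if)
  note eq_iff = powers_eq_iff[OF assms(1), where ?'k = 'k]
  have c: "?n \<and> ?M \<and> ?T" if "4 \<le> m" "?eq m" for m
  proof -
    have "\<And>a. covers \<Delta> m a \<Longrightarrow> packs \<Delta> m a" using that(2) unfolding eq_iff by blast
    from necessary[OF that(1) this assms(4)] show ?thesis by blast
  qed
  have b: "?eq m" if "?n \<and> ?M \<and> ?T" for m
  proof -
    from that obtain e1 e2 e3 T1 T2 where w:
      "{e1, e2, e3} \<subseteq> complement_graph (skeleton1 \<Delta>)" "e1 \<inter> e2 = {}" "e1 \<inter> e3 = {}" "e2 \<inter> e3 = {}"
      "triangle (skeleton1 \<Delta>) T1" "triangle (skeleton1 \<Delta>) T2" "T1 \<inter> T2 = {}"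
      by (elim conjE exE)
    show ?thesis
      unfolding eq_iff by (intro allI impI sufficient[OF conjunct1[OF that] w])
  qed
  \<comment> \<open>The exponent 4 meets both bounds on \<open>m\<close>, so (b) yields an instance
    to which \<open>c\<close> applies.\<close>
  have "?eq 4" if "\<forall>m\<ge>1. ?eq m" using that by simp
  then have all: "(\<forall>m\<ge>1. ?eq m) \<longleftrightarrow> ?n \<and> ?M \<and> ?T" using b c[of 4] by (metis order.refl)
  have "(\<exists>m\<ge>4. ?eq m) \<longleftrightarrow> ?n \<and> ?M \<and> ?T"
  proof
    assume "\<exists>m\<ge>4. ?eq m"
    then obtain m where "4 \<le> m" "?eq m" by iprover
    then show "?n \<and> ?M \<and> ?T" by (rule c)
  next
    assume "?n \<and> ?M \<and> ?T"
    then have "?eq 4" by (rule b)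
    then show "\<exists>m\<ge>4. ?eq m" by (intro exI[of _ 4] conjI order.refl)
  qed
  then show ?thesis unfolding all by (intro conjI refl)
qed

end
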